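(* Let $\mathcal H$ be a real or complex Hilbert space and let $(U_i)_{1\le i\le m}$ be a finite family of closed vector subspaces of $\mathcal H$ that satisfies the inverse best approximation property. Then the subspaces $(U_i)_{1\le i\le m}$ are linearly independent.
   Context: Let $P_i$ be the orthogonal projector onto $U_i$. The family $(U_i)_{1\le i\le m}$ satisfies the inverse best approximation property (IBAP) if for every $(u_1,\ldots,u_m)\in U_1\times\cdots\times U_m$ there exists $x\in\mathcal H$ such that $P_ix=u_i$ for every $i\in\{1,\ldots,m\}$. The subspaces $(U_i)_{1\le i\le m}$ are linearly independent if $u_i\in U_i$ for all $i$ and $\sum_{i=1}^mu_i=0$ imply $u_i=0$ for all $i$. *)

theory Defs
  imports "HOL-Analysis.Analysis"
begin

text \<open>
  Real Hilbert spaces are the types of sort \<open>{real_inner, complete_space}\<close>.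
  The classes below are the complex counterparts. The real normed structure is inherited from the
  library, with real scalar multiplication the restriction of the complex one and the norm the one
  induced by the inner product, so that \<open>closed\<close>, \<open>complete_space\<close> etc. have their usual meaning.
\<close>

class complex_vector = real_vector +
  fixes scaleC :: "complex \<Rightarrow> 'a \<Rightarrow> 'a" (infixr \<open>*\<^sub>C\<close> 75)
  assumes scaleC_add_right: "c *\<^sub>C (x + y) = c *\<^sub>C x + c *\<^sub>C y"
    and scaleC_add_left: "(c + d) *\<^sub>C x = c *\<^sub>C x + d *\<^sub>C x"
    and scaleC_scaleC: "c *\<^sub>C d *\<^sub>C x = (c * d) *\<^sub>C x"
    and scaleC_one: "1 *\<^sub>C x = x"
    and scaleR_scaleC: "r *\<^sub>R x = complex_of_real r *\<^sub>C x"

interpretation complex_vector: vector_space "scaleC :: complex \<Rightarrow> 'a \<Rightarrow> 'a::complex_vector"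
  by unfold_locales
    (simp_all add: scaleC_add_right scaleC_add_left scaleC_scaleC scaleC_one)

text \<open>The inner product is linear in its first argument.\<close>

class complex_inner = complex_vector + real_normed_vector +
  fixes cinner :: "'a \<Rightarrow> 'a \<Rightarrow> complex"
  assumes cinner_commute: "cinner x y = cnj (cinner y x)"
    and cinner_add_left: "cinner (x + y) z = cinner x z + cinner y z"
    and cinner_scaleC_left: "cinner (c *\<^sub>C x) y = c * cinner x y"
    and cinner_ge_zero: "0 \<le> Re (cinner x x)"
    and cinner_eq_zero_iff: "cinner x x = 0 \<longleftrightarrow> x = 0"
    and norm_eq_sqrt_cinner: "norm x = sqrt (Re (cinner x x))"

class complex_hilbert_space = complex_inner + complete_space

instantiation complex :: complex_hilbert_space
begin

definition "c *\<^sub>C (x::complex) = c * x"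
definition "cinner (x::complex) y = x * cnj y"

instance
  by standard
    (auto simp: scaleC_complex_def cinner_complex_def algebra_simps scaleR_conv_of_real
      cmod_def power2_eq_square)

end

text \<open>
  The following notions take the inner product \<open>ip\<close> as a parameter, to be instantiated with
  \<open>inner\<close> or \<open>cinner\<close>. If \<open>U\<close> is a closed subspace of a Hilbert space, the point described by
  \<open>THE\<close> exists and is unique.
\<close>

definition orth_projector ::
    "('a \<Rightarrow> 'a \<Rightarrow> 'k::zero) \<Rightarrow> 'a::ab_group_add set \<Rightarrow> 'a \<Rightarrow> 'a" where
  "orth_projector ip U x = (THE p. p \<in> U \<and> (\<forall>u\<in>U. ip (x - p) u = 0))"

definition inverse_best_approximation_property ::
    "('a \<Rightarrow> 'a \<Rightarrow> 'k::zero) \<Rightarrow> nat \<Rightarrow> (nat \<Rightarrow> 'a::ab_group_add set) \<Rightarrow> bool" where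
  "inverse_best_approximation_property ip m U \<longleftrightarrow>
     (\<forall>u. (\<forall>i\<in>{1..m}. u i \<in> U i) \<longrightarrow>
        (\<exists>x. \<forall>i\<in>{1..m}. orth_projector ip (U i) x = u i))"

definition linearly_independent_subspaces ::
    "nat \<Rightarrow> (nat \<Rightarrow> 'a::ab_group_add set) \<Rightarrow> bool" where
  "linearly_independent_subspaces m U \<longleftrightarrow>
     (\<forall>u. (\<forall>i\<in>{1..m}. u i \<in> U i) \<and> (\<Sum>i=1..m. u i) = 0 \<longrightarrow> (\<forall>i\<in>{1..m}. u i = 0))"

end

theory Submission
  imports Defs
begin

text \<open>
  Let \<open>\<Sum>i. u i = 0\<close> with \<open>u i \<in> U i\<close>, and let \<open>x\<close> be a point with projections \<open>P\<^sub>i x = u i\<close>. Since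
  \<open>x - u i\<close> is orthogonal to \<open>U i\<close>, and in particular to \<open>u i\<close>, one has
  \<open>\<langle>x, u i\<rangle> = \<parallel>u i\<parallel>\<^sup>2\<close>. Summing over \<open>i\<close> gives \<open>\<Sum>i. \<parallel>u i\<parallel>\<^sup>2 = \<langle>x, \<Sum>i. u i\<rangle> = 0\<close>, so every \<open>u i\<close>
  vanishes.

  The substance lies in showing that the projector, a definite description, does have the
  orthogonality property used here; this is the projection theorem for closed subspaces of a
  Hilbert space. The real and the complex case are handled together: the real part of a complex
  inner product is a real inner product with the same norm, and orthogonality to a complex
  subspace with respect to either form is the same, because such a subspace is invariant under
  multiplication by the imaginary unit.
\<close>

section \<open>The projection theorem\<close>

text \<open>
  Keeping the form a parameter allows \<open>inner\<close> and the real part of \<open>cinner\<close> to share one proof.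
\<close>

locale real_inner_form =
  fixes ip :: "'a::{real_normed_vector, complete_space} \<Rightarrow> 'a \<Rightarrow> real"
  assumes ip_commute: "ip x y = ip y x"
    and ip_add_left: "ip (x + y) z = ip x z + ip y z"
    and ip_scaleR_left: "ip (c *\<^sub>R x) y = c * ip x y"
    and ip_self: "ip x x = (norm x)\<^sup>2"
begin

sublocale left: linear "\<lambda>x. ip x y" for y
  by unfold_locales (simp_all add: ip_add_left ip_scaleR_left)

sublocale right: linear "ip x" for x
  by unfold_locales (simp_all add: ip_commute[of x] ip_add_left ip_scaleR_left)

lemma norm_add_scaleR_sq:
  "(norm (x + t *\<^sub>R y))\<^sup>2 = (norm x)\<^sup>2 + 2 * t * ip x y + t\<^sup>2 * (norm y)\<^sup>2"
  unfolding ip_self[symmetric]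
  by (simp add: left.add right.add left.scale right.scale ip_commute[of y x]
      power2_eq_square algebra_simps)

lemma parallelogram_law:
  fixes x y :: 'a
  shows "(norm (x + y))\<^sup>2 + (norm (x - y))\<^sup>2 = 2 * (norm x)\<^sup>2 + 2 * (norm y)\<^sup>2"
  using norm_add_scaleR_sq[of x 1 y] norm_add_scaleR_sq[of x "-1" y] by simp

text \<open>
  The points of \<open>S\<close> that almost realise the infimum \<open>d\<close> of the squared distances to \<open>x\<close> form a nested
  sequence of closed sets. The parallelogram law makes their diameters tend to \<open>0\<close>, because the
  midpoint of two such points lies in \<open>S\<close> and has squared distance at least \<open>d\<close> from \<open>x\<close>.
  Completeness then yields a common point.
\<close>

lemma nearest_point_exists:
  fixes x :: 'a
  assumes "closed S" "convex S" "S \<noteq> {}"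
  obtains p where "p \<in> S" "\<And>y. y \<in> S \<Longrightarrow> norm (x - p) \<le> norm (x - y)"
proof -
  define d where "d = (INF y\<in>S. (norm (x - y))\<^sup>2)"
  have bdd: "bdd_below ((\<lambda>y. (norm (x - y))\<^sup>2) ` S)"
    by (rule bdd_belowI2[of _ 0]) simp
  have d_le: "d \<le> (norm (x - y))\<^sup>2" if "y \<in> S" for y
    unfolding d_def using bdd that by (rule cINF_lower)
  define T where "T n = {y \<in> S. (norm (x - y))\<^sup>2 \<le> d + inverse (real (Suc n))}" for n
  have closed_T: "closed (T n)" for n
  proof -
    have "closed {y. (norm (x - y))\<^sup>2 \<le> d + inverse (real (Suc n))}"
      by (intro closed_Collect_le continuous_intros)
    moreover have "T n = S \<inter> {y. (norm (x - y))\<^sup>2 \<le> d + inverse (real (Suc n))}"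
      by (auto simp: T_def)
    ultimately show ?thesis using assms(1) by auto
  qed
  have nonempty_T: "T n \<noteq> {}" for n
  proof -
    have "(INF y\<in>S. (norm (x - y))\<^sup>2) < d + inverse (real (Suc n))"
      by (simp add: d_def)
    then obtain y where "y \<in> S" "(norm (x - y))\<^sup>2 < d + inverse (real (Suc n))"
      using assms(3) bdd by (auto simp: cINF_less_iff)
    then show ?thesis by (auto simp: T_def)
  qed
  have mono_T: "T n \<subseteq> T m" if "m \<le> n" for m n
  proof -
    have "inverse (real (Suc n)) \<le> inverse (real (Suc m))"
      using that by (intro le_imp_inverse_le) auto
    then show ?thesis
      unfolding T_def by (intro Collect_mono) (metis add_left_mono order_trans)
  qed
  have small_T: "(dist y z)\<^sup>2 \<le> 4 * inverse (real (Suc n))" if "y \<in> T n" "z \<in> T n" for y z n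
  proof -
    have "(1/2) *\<^sub>R y + (1/2) *\<^sub>R z \<in> S"
      using that assms(2) by (intro convexD) (auto simp: T_def)
    then have "d \<le> (norm (x - ((1/2) *\<^sub>R y + (1/2) *\<^sub>R z)))\<^sup>2" by (rule d_le)
    also have "x - ((1/2) *\<^sub>R y + (1/2) *\<^sub>R z) = (1/2) *\<^sub>R ((x - y) + (x - z))"
      by (simp add: algebra_simps flip: scaleR_left.add)
    also have "(norm \<dots>)\<^sup>2 = (norm ((x - y) + (x - z)))\<^sup>2 / 4"
      by (simp add: power_divide)
    finally have "4 * d \<le> (norm ((x - y) + (x - z)))\<^sup>2" by simp
    moreover have "(norm ((x - y) + (x - z)))\<^sup>2 + (norm ((x - y) - (x - z)))\<^sup>2
        = 2 * (norm (x - y))\<^sup>2 + 2 * (norm (x - z))\<^sup>2"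
      by (rule parallelogram_law)
    moreover have "(norm ((x - y) - (x - z)))\<^sup>2 = (dist y z)\<^sup>2"
      by (simp add: dist_norm norm_minus_commute)
    moreover have "(norm (x - y))\<^sup>2 \<le> d + inverse (real (Suc n))"
      "(norm (x - z))\<^sup>2 \<le> d + inverse (real (Suc n))"
      using that by (auto simp: T_def)
    ultimately show ?thesis by linarith
  qed
  have "\<exists>n. \<forall>y\<in>T n. \<forall>z\<in>T n. dist y z < e" if "e > 0" for e
  proof -
    obtain n where n: "inverse (real (Suc n)) < e\<^sup>2 / 4"
      using reals_Archimedean[of "e\<^sup>2 / 4"] \<open>e > 0\<close> by (auto simp del: of_nat_Suc)
    have "dist y z < e" if "y \<in> T n" "z \<in> T n" for y z
    proof (rule power2_less_imp_less)
      show "(dist y z)\<^sup>2 < e\<^sup>2" using small_T[OF that] n by linarith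
    qed (use \<open>e > 0\<close> in simp)
    then show ?thesis by blast
  qed
  with closed_T nonempty_T mono_T obtain p where p: "\<And>n. p \<in> T n"
    using decreasing_closed_nest[of T] by metis
  show ?thesis
  proof
    show "p \<in> S" using p[of 0] by (simp add: T_def)
    fix y assume "y \<in> S"
    have "(norm (x - p))\<^sup>2 \<le> d"
    proof (rule field_le_epsilon)
      fix e :: real assume "0 < e"
      then obtain n where "inverse (real (Suc n)) < e" using reals_Archimedean by blast
      then show "(norm (x - p))\<^sup>2 \<le> d + e" using p[of n] by (simp add: T_def)
    qed
    also note d_le[OF \<open>y \<in> S\<close>]
    finally show "norm (x - p) \<le> norm (x - y)" by simp
  qed
qed

lemma orthogonal_if_nearest:
  assumes "subspace S" "p \<in> S" "u \<in> S"
    and nearest: "\<And>y. y \<in> S \<Longrightarrow> norm (x - p) \<le> norm (x - y)"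
  shows "ip (x - p) u = 0"
proof (cases "u = 0")
  case False
  \<comment> \<open>The point \<open>p + t *\<^sub>R u\<close> is the one closest to \<open>x\<close> on the line through \<open>p\<close> in direction \<open>u\<close>.\<close>
  define t where "t = ip (x - p) u / (norm u)\<^sup>2"
  have "p + t *\<^sub>R u \<in> S"
    using assms by (simp add: subspace_add subspace_scale)
  from nearest[OF this] have "(norm (x - p))\<^sup>2 \<le> (norm ((x - p) + (- t) *\<^sub>R u))\<^sup>2"
    by (simp add: algebra_simps)
  also have "\<dots> = (norm (x - p))\<^sup>2 - (ip (x - p) u)\<^sup>2 / (norm u)\<^sup>2"
    unfolding norm_add_scaleR_sq using False by (simp add: t_def field_simps power2_eq_square)
  finally have "(ip (x - p) u)\<^sup>2 / (norm u)\<^sup>2 \<le> 0" by simp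
  then show ?thesis using False by (simp add: divide_le_0_iff)
qed (simp add: right.zero)

theorem orthogonal_projection_ex1:
  assumes "closed S" "subspace S"
  shows "\<exists>!p. p \<in> S \<and> (\<forall>u\<in>S. ip (x - p) u = 0)"
proof -
  obtain p where "p \<in> S" "\<And>y. y \<in> S \<Longrightarrow> norm (x - p) \<le> norm (x - y)"
    using nearest_point_exists[of S x] assms subspace_imp_convex subspace_0 by blast
  then have "p \<in> S \<and> (\<forall>u\<in>S. ip (x - p) u = 0)"
    using orthogonal_if_nearest assms(2) by blast
  moreover have "p = q"
    if p: "p \<in> S" "\<forall>u\<in>S. ip (x - p) u = 0" and q: "q \<in> S" "\<forall>u\<in>S. ip (x - q) u = 0" for p q
  proof -
    have "p - q \<in> S" using p q assms(2) by (simp add: subspace_diff)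
    then have "ip (x - q) (p - q) - ip (x - p) (p - q) = 0" using p q by simp
    then have "ip (p - q) (p - q) = 0" by (simp add: left.diff)
    then show ?thesis by (simp add: ip_self)
  qed
  ultimately show ?thesis by blast
qed

section \<open>Linear independence\<close>

lemma vanishing_if_residuals_orthogonal:
  assumes "finite I" "\<And>i. i \<in> I \<Longrightarrow> ip (x - u i) (u i) = 0" "(\<Sum>i\<in>I. u i) = 0" "i \<in> I"
  shows "u i = 0"
proof -
  have "(\<Sum>i\<in>I. (norm (u i))\<^sup>2) = (\<Sum>i\<in>I. ip x (u i))"
    using assms(2) by (intro sum.cong) (simp_all add: left.diff ip_self)
  also have "\<dots> = 0" by (simp add: assms(3) right.zero flip: right.sum)
  finally show ?thesis using assms(1,4) by (simp add: sum_nonneg_eq_0_iff)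
qed

text \<open>
  The form \<open>cp\<close> that defines the projectors is either \<open>ip\<close> itself or a complex inner product with
  real part \<open>ip\<close>.
\<close>

lemma linearly_independent_if_ibap:
  fixes cp :: "'a \<Rightarrow> 'a \<Rightarrow> 'k::zero"
  assumes closed: "\<And>i. i \<in> {1..m} \<Longrightarrow> closed (U i)"
    and subspace: "\<And>i. i \<in> {1..m} \<Longrightarrow> subspace (U i)"
    and orth_iff: "\<And>i x. i \<in> {1..m} \<Longrightarrow> (\<forall>u\<in>U i. cp x u = 0) \<longleftrightarrow> (\<forall>u\<in>U i. ip x u = 0)"
    and ibap: "inverse_best_approximation_property cp m U"
  shows "linearly_independent_subspaces m U"
  unfolding linearly_independent_subspaces_def
proof (intro allI impI, elim conjE)
  fix u assume u: "\<forall>i\<in>{1..m}. u i \<in> U i" and sum: "(\<Sum>i=1..m. u i) = 0"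
  from ibap u obtain x where x: "\<And>i. i \<in> {1..m} \<Longrightarrow> orth_projector cp (U i) x = u i"
    unfolding inverse_best_approximation_property_def by blast
  have "ip (x - u i) (u i) = 0" if i: "i \<in> {1..m}" for i
  proof -
    have "u i = (THE p. p \<in> U i \<and> (\<forall>v\<in>U i. ip (x - p) v = 0))"
      using x[OF i] by (simp add: orth_projector_def orth_iff[OF i])
    then show ?thesis
      using theI'[OF orthogonal_projection_ex1[OF closed[OF i] subspace[OF i], of x]] u i by auto
  qed
  then show "\<forall>i\<in>{1..m}. u i = 0"
    using vanishing_if_residuals_orthogonal[OF _ _ sum] by blast
qed

end

section \<open>Real and complex Hilbert spaces\<close>

lemma real_inner_form_inner:
  "real_inner_form (inner :: 'a::{real_inner, complete_space} \<Rightarrow> 'a \<Rightarrow> real)"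
  by unfold_locales
    (simp_all add: inner_add_left power2_norm_eq_inner, rule inner_commute)

lemma real_inner_form_Re_cinner:
  "real_inner_form (\<lambda>x y :: 'b::complex_hilbert_space. Re (cinner x y))"
proof
  fix x y :: 'b
  show "Re (cinner x y) = Re (cinner y x)" by (subst cinner_commute) simp
  show "Re (cinner x x) = (norm x)\<^sup>2" by (simp add: norm_eq_sqrt_cinner cinner_ge_zero)
qed (simp_all add: cinner_add_left scaleR_scaleC cinner_scaleC_left)

lemma complex_subspace_imp_subspace: "complex_vector.subspace V \<Longrightarrow> subspace V"
  by (auto simp: subspace_def complex_vector.subspace_def scaleR_scaleC)

lemma cinner_scaleC_right: "cinner x (c *\<^sub>C y) = cnj c * cinner x y"
  by (subst (1 2) cinner_commute) (simp add: cinner_scaleC_left)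

text \<open>The imaginary part of \<open>cinner x v\<close> is the real part of \<open>cinner x (\<i> *\<^sub>C v)\<close>.\<close>

lemma cinner_orthogonal_iff_Re:
  assumes "complex_vector.subspace V"
  shows "(\<forall>v\<in>V. cinner x v = 0) \<longleftrightarrow> (\<forall>v\<in>V. Re (cinner x v) = 0)"
proof
  assume *: "\<forall>v\<in>V. Re (cinner x v) = 0"
  show "\<forall>v\<in>V. cinner x v = 0"
  proof
    fix v assume "v \<in> V"
    then have "Re (cinner x v) = 0" "Re (cinner x (\<i> *\<^sub>C v)) = 0"
      using * complex_vector.subspace_scale[OF assms] by auto
    then show "cinner x v = 0" by (simp add: complex_eq_iff cinner_scaleC_right)
  qed
qed auto

theorem corollary2p3:
  fixes U :: "nat \<Rightarrow> 'a::{real_inner, complete_space} set"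
    and V :: "nat \<Rightarrow> 'b::complex_hilbert_space set"
    and m :: nat
  shows "((\<forall>i\<in>{1..m}. closed (U i) \<and> subspace (U i)) \<and>
            inverse_best_approximation_property inner m U
          \<longrightarrow> linearly_independent_subspaces m U) \<and>
         ((\<forall>i\<in>{1..m}. closed (V i) \<and> complex_vector.subspace (V i)) \<and>
            inverse_best_approximation_property cinner m V
          \<longrightarrow> linearly_independent_subspaces m V)"
proof (intro conjI impI; elim conjE)
  assume U: "\<forall>i\<in>{1..m}. closed (U i) \<and> subspace (U i)"
    and ibap: "inverse_best_approximation_property inner m U"
  show "linearly_independent_subspaces m U"
    by (rule real_inner_form.linearly_independent_if_ibap[OF real_inner_form_inner _ _ _ ibap])
      (use U in auto)
next
  assume V: "\<forall>i\<in>{1..m}. closed (V i) \<and> complex_vector.subspace (V i)"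
    and ibap: "inverse_best_approximation_property cinner m V"
  show "linearly_independent_subspaces m V"
    by (rule real_inner_form.linearly_independent_if_ibap
          [OF real_inner_form_Re_cinner _ _ cinner_orthogonal_iff_Re ibap])
      (use V in \<open>auto intro: complex_subspace_imp_subspace\<close>)
qed

end
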